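(* For every sequent $\Gamma\Rightarrow\Delta$: if $\Gamma\Rightarrow\Delta$ is provable in $\mathsf{Grz}_\infty+\mathsf{cut}$, then $\Gamma\Rightarrow\Delta$ is provable in $\mathsf{Grz}_\infty$.
   Context: Formulas are given by $A ::= \bot \mid p \mid (A\to A)\mid \Box A$, where $p$ ranges over atomic propositions. A sequent is an expression $\Gamma\Rightarrow\Delta$ with $\Gamma,\Delta$ finite multisets of formulas; a comma denotes multiset union, and for $\Gamma=A_1,\dots,A_n$ we set $\Box\Gamma:=\Box A_1,\dots,\Box A_n$. The calculus $\mathsf{Grz}_\infty$ has initial sequents $\Gamma,p\Rightarrow p,\Delta$ ($p$ atomic) and $\Gamma,\bot\Rightarrow\Delta$, and the following rules (for all formulas $A,B$ and finite multisets $\Gamma,\Delta,\Pi$): - $(\to_L)$: from $\Gamma,B\Rightarrow\Delta$ (left premise) and $\Gamma\Rightarrow A,\Delta$ (right premise) infer $\Gamma,A\to B\Rightarrow\Delta$; - $(\to_R)$: from $\Gamma,A\Rightarrow B,\Delta$ infer $\Gamma\Rightarrow A\to B,\Delta$; - $(\mathsf{refl})$: from $\Gamma,A,\Box A\Rightarrow\Delta$ infer $\Gamma,\Box A\Rightarrow\Delta$; - $(\Box)$: from $\Gamma,\Box\Pi\Rightarrow A,\Delta$ (left premise) and $\Box\Pi\Rightarrow A$ (right premise) infer $\Gamma,\Box\Pi\Rightarrow\Box A,\Delta$. The calculus $\mathsf{Grz}_\infty+\mathsf{cut}$ additionally has the rule $(\mathsf{cut})$: from $\Gamma\Rightarrow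 A,\Delta$ and $\Gamma,A\Rightarrow\Delta$ infer $\Gamma\Rightarrow\Delta$. An $\infty$-proof in either system is a possibly infinite tree whose nodes are marked by sequents and whose leaves are marked by initial sequents, constructed according to the rules of the system, such that every infinite branch passes through a right premise of the rule $(\Box)$ infinitely many times. A sequent is provable in the system if it marks the root of some $\infty$-proof in the system. *)

theory Defs
  imports "HOL-Library.Multiset"
begin

datatype 'a fm = Bot | Atom 'a | Imp "'a fm" "'a fm" | Box "'a fm"

datatype 'a sequent = Sequent "'a fm multiset" "'a fm multiset"  (infix "\<Rightarrow>\<^sub>s" 45)

datatype rname = Initial | ImpL | ImpR | Refl | BoxRule | Cut

text \<open>
  An inference consists of a rule name, the list of premises from left to right, and the conclusion.
  Initial sequents are inferences without premises, and no other inference has this form; so the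
  leaves of a derivation are exactly the nodes justified by \<open>Initial\<close>.
\<close>

inductive grz :: "rname \<Rightarrow> 'a sequent list \<Rightarrow> 'a sequent \<Rightarrow> bool" where
  init_atom: "grz Initial [] (\<Gamma> + {#Atom p#} \<Rightarrow>\<^sub>s {#Atom p#} + \<Delta>)"
| init_bot: "grz Initial [] (\<Gamma> + {#Bot#} \<Rightarrow>\<^sub>s \<Delta>)"
| impL: "grz ImpL [\<Gamma> + {#B#} \<Rightarrow>\<^sub>s \<Delta>, \<Gamma> \<Rightarrow>\<^sub>s {#A#} + \<Delta>] (\<Gamma> + {#Imp A B#} \<Rightarrow>\<^sub>s \<Delta>)"
| impR: "grz ImpR [\<Gamma> + {#A#} \<Rightarrow>\<^sub>s {#B#} + \<Delta>] (\<Gamma> \<Rightarrow>\<^sub>s {#Imp A B#} + \<Delta>)"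
| refl: "grz Refl [\<Gamma> + {#A#} + {#Box A#} \<Rightarrow>\<^sub>s \<Delta>] (\<Gamma> + {#Box A#} \<Rightarrow>\<^sub>s \<Delta>)"
| box: "grz BoxRule
          [\<Gamma> + image_mset Box \<Pi> \<Rightarrow>\<^sub>s {#A#} + \<Delta>, image_mset Box \<Pi> \<Rightarrow>\<^sub>s {#A#}]
          (\<Gamma> + image_mset Box \<Pi> \<Rightarrow>\<^sub>s {#Box A#} + \<Delta>)"

inductive grz_cut :: "rname \<Rightarrow> 'a sequent list \<Rightarrow> 'a sequent \<Rightarrow> bool" where
  base: "grz r ps s \<Longrightarrow> grz_cut r ps s"
| cut: "grz_cut Cut [\<Gamma> \<Rightarrow>\<^sub>s {#A#} + \<Delta>, \<Gamma> + {#A#} \<Rightarrow>\<^sub>s \<Delta>] (\<Gamma> \<Rightarrow>\<^sub>s \<Delta>)"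

codatatype 'a ptree = Node (concl: "'a sequent") (rule_of: rname) (subtrees: "'a ptree list")

coinductive derivation ::
  "(rname \<Rightarrow> 'a sequent list \<Rightarrow> 'a sequent \<Rightarrow> bool) \<Rightarrow> 'a ptree \<Rightarrow> bool"
  for calc where
  "\<lbrakk>calc r (map concl ts) s; \<forall>t \<in> set ts. derivation calc t\<rbrakk> \<Longrightarrow> derivation calc (Node s r ts)"

text \<open>
  An infinite branch of \<open>t\<close> is given by the subtrees \<open>b n\<close> rooted at its successive nodes and the
  positions \<open>d n\<close> of the premises it follows.
\<close>

definition infinite_branch :: "'a ptree \<Rightarrow> (nat \<Rightarrow> 'a ptree) \<Rightarrow> (nat \<Rightarrow> nat) \<Rightarrow> bool" where
  "infinite_branch t b d \<longleftrightarrow> b 0 = t \<and>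
     (\<forall>n. d n < length (subtrees (b n)) \<and> b (Suc n) = subtrees (b n) ! d n)"

text \<open>
  Premises are counted from 0, so \<open>d n = 1\<close> at a node justified by \<open>BoxRule\<close> means that the branch
  continues to the right premise.
\<close>

definition infinity_proof ::
  "(rname \<Rightarrow> 'a sequent list \<Rightarrow> 'a sequent \<Rightarrow> bool) \<Rightarrow> 'a ptree \<Rightarrow> bool" where
  "infinity_proof calc t \<longleftrightarrow> derivation calc t \<and>
     (\<forall>b d. infinite_branch t b d \<longrightarrow> infinite {n. rule_of (b n) = BoxRule \<and> d n = 1})"

definition provable ::
  "(rname \<Rightarrow> 'a sequent list \<Rightarrow> 'a sequent \<Rightarrow> bool) \<Rightarrow> 'a sequent \<Rightarrow> bool" where
  "provable calc s \<longleftrightarrow> (\<exists>t. infinity_proof calc t \<and> concl t = s)"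

end

theory Submission imports Defs "HOL-Library.Infinite_Set" begin

text \<open>
  The proof goes through Kripke semantics. The models are finite trees, ordered by the reflexive
  and transitive subtree relation, and three observations suffice.

  \<^item> Soundness of the calculus with cut (\<open>refutes_concl_contradiction\<close>). Suppose that a world
    refutes the conclusion of an \<open>\<infinity>\<close>-proof. Every inference has a premise that is refuted at the
    same world, or, for the right premise of the box rule, at a proper subtree. Following these
    premises yields an infinite branch. It passes through right premises infinitely often, so
    the size of the world, which never grows, decreases infinitely often, which is impossible.

  \<^item> Local completeness of the cut-free calculus (\<open>sound_goal_step\<close>). A valid sequent is decomposed
    bottom-up by inferences whose premises inherit its validity. The rule \<open>Refl\<close> keeps its principal formula, so
    the left boxes to which it was already applied are recorded separately. With these boxes
    discounted, every premise other than a right premise of the box rule is smaller than the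
    conclusion. A right premise is only taken when it is itself valid; if the decomposition
    got stuck, the countermodels of all right premises could be glued below a new root.

  \<^item> Unfolding the second point corecursively gives a cut-free derivation of every valid
    sequent. Along a branch that takes right premises only finitely often the measure would
    eventually decrease forever, so the derivation is an \<open>\<infinity>\<close>-proof.
\<close>

section \<open>Finite tree models\<close>

datatype 'a kripke = World (valuation: "'a set") (children: "'a kripke list")

primrec reach :: "'a kripke \<Rightarrow> 'a kripke set" where
  "reach (World V ws) = insert (World V ws) (\<Union>(set (map reach ws)))"

primrec sat :: "'a fm \<Rightarrow> 'a kripke \<Rightarrow> bool" where
  "sat Bot w \<longleftrightarrow> False"
| "sat (Atom p) w \<longleftrightarrow> p \<in> valuation w"
| "sat (Imp A B) w \<longleftrightarrow> (sat A w \<longrightarrow> sat B w)"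
| "sat (Box A) w \<longleftrightarrow> (\<forall>u \<in> reach w. sat A u)"

fun refutes :: "'a kripke \<Rightarrow> 'a sequent \<Rightarrow> bool" where
  "refutes w (\<Gamma> \<Rightarrow>\<^sub>s \<Delta>) \<longleftrightarrow> (\<forall>A \<in># \<Gamma>. sat A w) \<and> (\<forall>A \<in># \<Delta>. \<not> sat A w)"

lemma reach_unfold: "reach w = insert w (\<Union>v \<in> set (children w). reach v)"
  by (cases w) simp

lemma reach_self: "w \<in> reach w"
  by (subst reach_unfold) simp

lemma reach_trans: "v \<in> reach w \<Longrightarrow> u \<in> reach v \<Longrightarrow> u \<in> reach w"
proof (induction w)
  case (World V ws)
  then show ?case by (cases "v = World V ws") auto
qed

lemma reach_size: "u \<in> reach w \<Longrightarrow> u = w \<or> size u < size w"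
proof (induction w)
  case (World V ws)
  have "size u < size (World V ws)" if v: "v \<in> set ws" and u: "u \<in> reach v" for v
  proof -
    have "size u \<le> size v" using World.IH[OF v u] by auto
    also have "size v \<le> size_list size ws" using v by (simp add: size_list_estimation')
    finally show ?thesis by simp
  qed
  then show ?case using World.prems by auto
qed

lemma sat_Box_refl: "sat (Box A) w \<Longrightarrow> sat A w"
  by (simp add: reach_self)

lemma sat_Box_mono: "sat (Box A) w \<Longrightarrow> v \<in> reach w \<Longrightarrow> sat (Box A) v"
  using reach_trans by fastforce

lemma sat_Box_children:
  "sat (Box A) w \<longleftrightarrow> sat A w \<and> (\<forall>v \<in> set (children w). sat (Box A) v)"
  by (simp add: reach_unfold[of w])

section \<open>Soundness of the calculus with cut\<close>

text \<open>
  For the box rule, a refuted \<open>\<box>A\<close> fails because \<open>A\<close> is false at the current world, which leads to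
  the left premise, or at a proper subtree, which leads to the right premise because boxed
  formulas persist.
\<close>

lemma grz_refuted_premise:
  assumes "grz r ps s" and "refutes w s"
  shows "\<exists>i u. i < length ps \<and> refutes u (ps ! i) \<and>
           (if r = BoxRule \<and> i = 1 then size u < size w else u = w)"
  using assms
proof (cases rule: grz.cases)
  case (impL \<Gamma> B \<Delta> A)
  show ?thesis
  proof (cases "sat A w")
    case True
    then show ?thesis using impL assms(2) by (intro exI[of _ 0] exI[of _ w]) auto
  next
    case False
    then show ?thesis using impL assms(2) by (intro exI[of _ 1] exI[of _ w]) auto
  qed
next
  case (impR \<Gamma> A B \<Delta>)
  then show ?thesis using assms(2) by (intro exI[of _ 0] exI[of _ w]) auto
next
  case (refl \<Gamma> A \<Delta>)
  then show ?thesis using assms(2) sat_Box_refl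
    by (intro exI[of _ 0] exI[of _ w]) auto
next
  case (box \<Gamma> \<Pi> A \<Delta>)
  show ?thesis
  proof (cases "sat A w")
    case False
    then show ?thesis using box assms(2) by (intro exI[of _ 0] exI[of _ w]) auto
  next
    case True
    have "\<not> sat (Box A) w" using box assms(2) by simp
    then obtain u where u: "u \<in> reach w" "\<not> sat A u" by auto
    with True have "size u < size w" using reach_size by blast
    moreover have "refutes u (image_mset Box \<Pi> \<Rightarrow>\<^sub>s {#A#})"
      using box assms(2) u sat_Box_mono[OF _ u(1)] by (auto simp del: sat.simps)
    ultimately show ?thesis using box by (intro exI[of _ 1] exI[of _ u]) auto
  qed
qed auto

lemma grz_cut_refuted_premise:
  assumes "grz_cut r ps s" and "refutes w s"
  shows "\<exists>i u. i < length ps \<and> refutes u (ps ! i) \<and>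
           (if r = BoxRule \<and> i = 1 then size u < size w else u = w)"
  using assms(1)
proof (cases rule: grz_cut.cases)
  case base
  then show ?thesis using grz_refuted_premise assms(2) by blast
next
  case (cut \<Gamma> A \<Delta>)
  show ?thesis
  proof (cases "sat A w")
    case True
    then show ?thesis using cut assms(2) by (intro exI[of _ 1] exI[of _ w]) auto
  next
    case False
    then show ?thesis using cut assms(2) by (intro exI[of _ 0] exI[of _ w]) auto
  qed
qed

lemma no_infinitely_often_decreasing:
  fixes f :: "nat \<Rightarrow> nat"
  assumes "\<And>n. f (Suc n) \<le> f n" and "infinite {n. P n}" and "\<And>n. P n \<Longrightarrow> f (Suc n) < f n"
  shows False
proof -
  have anti: "f n \<le> f m" if "m \<le> n" for m n
    using that assms(1) by (rule lift_Suc_antimono_le[rotated])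
  define k where "k = (LEAST v. v \<in> range f)"
  have "k \<in> range f" unfolding k_def by (rule LeastI[of _ "f 0"]) simp
  then obtain m where m: "f m = k" by auto
  obtain n where n: "n \<ge> m" "P n" using assms(2) unfolding infinite_nat_iff_unbounded_le by blast
  have "f (Suc n) < k" using assms(3)[OF n(2)] anti[OF n(1)] m by simp
  moreover have "k \<le> f (Suc n)" unfolding k_def by (rule Least_le) simp
  ultimately show False by simp
qed

lemma refutes_concl_contradiction:
  fixes t :: "'a ptree" and w :: "'a kripke"
  assumes "infinity_proof grz_cut t" and "refutes w (concl t)"
  shows False
proof -
  define ok where "ok x \<longleftrightarrow> derivation grz_cut (fst x) \<and> refutes (snd x) (concl (fst x))"
    for x :: "'a ptree \<times> 'a kripke"
  define next_at where "next_at x y i \<longleftrightarrow>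
      i < length (subtrees (fst x)) \<and> fst y = subtrees (fst x) ! i \<and>
      (if rule_of (fst x) = BoxRule \<and> i = 1 then size (snd y) < size (snd x) else snd y = snd x)"
    for x y :: "'a ptree \<times> 'a kripke" and i
  have "\<exists>y. ok y \<and> (\<exists>i. next_at x y i)" if "ok x" for x
  proof -
    obtain s r ts v where x: "x = (Node s r ts, v)" by (metis surj_pair ptree.exhaust)
    have "derivation grz_cut (Node s r ts)" and v: "refutes v s"
      using that by (auto simp: ok_def x)
    then have calc: "grz_cut r (map concl ts) s" and sub: "\<forall>t' \<in> set ts. derivation grz_cut t'"
      by (auto elim: derivation.cases)
    obtain i u where "i < length ts" "refutes u (map concl ts ! i)"
      "if r = BoxRule \<and> i = 1 then size u < size v else u = v"
      using grz_cut_refuted_premise[OF calc v] by auto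
    then show ?thesis using sub
      by (intro exI[of _ "(ts ! i, u)"] conjI exI[of _ i]) (auto simp: ok_def next_at_def x)
  qed
  moreover have "ok (t, w)" using assms by (simp add: ok_def infinity_proof_def)
  \<comment> \<open>The clause for \<open>n = 0\<close> in the invariant pins the start of the chosen sequence to the root.\<close>
  ultimately obtain f where f0: "f 0 = (t, w)" and "\<And>n. ok (f n)"
    and "\<And>n. \<exists>i. next_at (f n) (f (Suc n)) i"
    using dependent_nat_choice[of "\<lambda>n x. ok x \<and> (n = 0 \<longrightarrow> x = (t, w))"
        "\<lambda>_ x y. \<exists>i. next_at x y i"] by (metis nat.distinct(1))
  then obtain d where d: "\<And>n. next_at (f n) (f (Suc n)) (d n)" by metis
  have "infinite_branch t (\<lambda>n. fst (f n)) d"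
    using d f0 by (auto simp: infinite_branch_def next_at_def)
  then have inf: "infinite {n. rule_of (fst (f n)) = BoxRule \<and> d n = 1}"
    using assms(1) by (auto simp: infinity_proof_def)
  have "size (snd (f (Suc n))) \<le> size (snd (f n))" for n
    using d[of n] by (auto simp: next_at_def split: if_splits)
  moreover note inf
  moreover have "size (snd (f (Suc n))) < size (snd (f n))"
    if "rule_of (fst (f n)) = BoxRule \<and> d n = 1" for n
    using d[of n] that by (auto simp: next_at_def)
  ultimately show False
    by (rule no_infinitely_often_decreasing[where f = "\<lambda>n. size (snd (f n))"])
qed

section \<open>Unfolding steps into a proof\<close>

text \<open>
  A coinductive invariant whose members can be justified by members, with a measure that
  decreases along all premises except the right premises of the box rule, describes an
  \<open>\<infinity>\<close>-proof: choose a justification for every member and unfold.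
\<close>

primcorec unfold_proof ::
  "('s \<Rightarrow> 'a sequent) \<Rightarrow> ('s \<Rightarrow> rname) \<Rightarrow> ('s \<Rightarrow> 's list) \<Rightarrow> 's \<Rightarrow> 'a ptree" where
  "unfold_proof sq R P x = Node (sq x) (R x) (map (unfold_proof sq R P) (P x))"

lemma provable_if_steps:
  fixes \<mu> :: "'s \<Rightarrow> nat"
  assumes step: "\<And>x. good x \<Longrightarrow> \<exists>r xs. calc r (map sq xs) (sq x) \<and>
      (\<forall>i < length xs. good (xs ! i) \<and> (r = BoxRule \<and> i = 1 \<or> \<mu> (xs ! i) < \<mu> x))"
    and "good x0"
  shows "provable calc (sq x0)"
proof -
  obtain R P where calc: "\<And>x. good x \<Longrightarrow> calc (R x) (map sq (P x)) (sq x)"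
    and prem: "\<And>x i. good x \<Longrightarrow> i < length (P x) \<Longrightarrow>
      good (P x ! i) \<and> (R x = BoxRule \<and> i = 1 \<or> \<mu> (P x ! i) < \<mu> x)"
    using step by metis
  let ?u = "unfold_proof sq R P"
  have concl_u: "concl \<circ> ?u = sq" by auto
  have "derivation calc (?u x)" if "good x" for x
    using that
  proof (coinduction arbitrary: x)
    case (derivation x)
    have node: "?u x = Node (sq x) (R x) (map ?u (P x))" by (rule unfold_proof.code)
    have "good y" if "y \<in> set (P x)" for y
      using that prem[OF derivation] by (auto simp: in_set_conv_nth)
    then show ?case using calc[OF derivation]
      by (intro exI[of _ "map ?u (P x)"] exI[of _ "sq x"] exI[of _ "R x"] conjI node)
        (auto simp: concl_u)
  qed
  moreover have "infinite {n. rule_of (b n) = BoxRule \<and> d n = 1}"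
    if br: "infinite_branch (?u x0) b d" for b d
  proof
    assume "finite {n. rule_of (b n) = BoxRule \<and> d n = 1}"
    then obtain N where N: "\<And>n. n \<ge> N \<Longrightarrow> \<not> (rule_of (b n) = BoxRule \<and> d n = 1)"
      by (auto simp: finite_nat_set_iff_bounded_le) (metis not_less_eq_eq)
    define x where "x = rec_nat x0 (\<lambda>n y. P y ! d n)"
    have x_Suc: "x (Suc n) = P (x n) ! d n" for n by (simp add: x_def)
    have x: "good (x n) \<and> b n = ?u (x n)" for n
    proof (induction n)
      case 0
      then show ?case using br \<open>good x0\<close> by (simp add: x_def infinite_branch_def)
    next
      case (Suc n)
      moreover have "d n < length (subtrees (b n))" "b (Suc n) = subtrees (b n) ! d n"
        using br by (auto simp: infinite_branch_def)
      ultimately show ?case using prem[of "x n" "d n"] by (simp add: x_Suc)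
    qed
    have "d n < length (P (x n))" for n
      using br x[of n] by (auto simp: infinite_branch_def dest: spec[of _ n])
    then have decr: "\<mu> (x (Suc n)) < \<mu> (x n)" if "n \<ge> N" for n
      using prem[of "x n" "d n"] x[of n] N[OF that] by (auto simp: x_Suc)
    have "\<mu> (x (N + n)) + n \<le> \<mu> (x N)" for n
    proof (induction n)
      case (Suc n)
      then show ?case using decr[of "N + n"] by simp
    qed simp
    from this[of "Suc (\<mu> (x N))"] show False by simp
  qed
  ultimately have "infinity_proof calc (?u x0)" using \<open>good x0\<close> by (auto simp: infinity_proof_def)
  then show ?thesis unfolding provable_def by (intro exI[of _ "?u x0"]) simp
qed

section \<open>Local completeness of the cut-free calculus\<close>

text \<open>
  In a goal \<open>(\<Gamma>, \<Theta>, \<Delta>)\<close> the boxes of \<open>\<Theta>\<close> are those to which \<open>Refl\<close> has already been applied. The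
  components of \<open>\<Theta>\<close> went into \<open>\<Gamma>\<close>, so a countermodel only has to make \<open>\<box>\<Theta>\<close> true above the
  root; this is the meaning of \<open>sound_goal\<close>, and it makes discounting \<open>\<Theta>\<close> in the weight possible.
\<close>

type_synonym 'a goal = "'a fm multiset \<times> 'a fm multiset \<times> 'a fm multiset"

fun goal_sequent :: "'a goal \<Rightarrow> 'a sequent" where
  "goal_sequent (\<Gamma>, \<Theta>, \<Delta>) = (\<Gamma> + image_mset Box \<Theta> \<Rightarrow>\<^sub>s \<Delta>)"

fun goal_weight :: "'a goal \<Rightarrow> nat" where
  "goal_weight (\<Gamma>, \<Theta>, \<Delta>) = (\<Sum>A \<in># \<Gamma>. size A) + (\<Sum>A \<in># \<Delta>. size A)"

fun sound_goal :: "'a goal \<Rightarrow> bool" where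
  "sound_goal (\<Gamma>, \<Theta>, \<Delta>) \<longleftrightarrow> (\<forall>w. refutes w (\<Gamma> \<Rightarrow>\<^sub>s \<Delta>) \<longrightarrow>
     (\<exists>v \<in> set (children w). \<exists>A \<in># \<Theta>. \<not> sat (Box A) v))"

text \<open>
  Otherwise every \<open>\<box>A\<close> on the right comes with a countermodel of \<open>\<box>\<Theta> \<Rightarrow> A\<close>. Taking these as the
  children of a new root, whose valuation is read off from the atoms on the left, gives a
  countermodel of the goal itself.
\<close>

lemma sound_goal_irreducible:
  assumes sound: "sound_goal (\<Gamma>, \<Theta>, \<Delta>)"
    and left: "\<And>A. A \<in># \<Gamma> \<Longrightarrow> \<exists>p. A = Atom p"
    and right: "\<And>A B. Imp A B \<notin># \<Delta>"
    and disjoint: "\<And>p. Atom p \<in># \<Gamma> \<Longrightarrow> Atom p \<notin># \<Delta>"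
  obtains (choose) A where "Box A \<in># \<Delta>" "sound_goal (image_mset Box \<Theta>, {#}, {#A#})"
proof (rule ccontr)
  assume no_box: "\<not> thesis"
  have "\<exists>w. refutes w (image_mset Box \<Theta> \<Rightarrow>\<^sub>s {#A#})" if box: "Box A \<in># \<Delta>" for A
  proof -
    have "\<not> sound_goal (image_mset Box \<Theta>, {#}, {#A#})" using no_box choose[OF box] by blast
    then show ?thesis by auto
  qed
  then obtain m where m: "\<And>A. Box A \<in># \<Delta> \<Longrightarrow> refutes (m A) (image_mset Box \<Theta> \<Rightarrow>\<^sub>s {#A#})"
    by metis
  have "finite {A. Box A \<in># \<Delta>}"
    using finite_vimageI[of "set_mset \<Delta>" Box] by (simp add: vimage_def inj_def)
  then obtain As where As: "set As = {A. Box A \<in># \<Delta>}" using finite_list by blast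
  define w where "w = World {p. Atom p \<in># \<Gamma>} (map m As)"
  have "\<not> sat B w" if B: "B \<in># \<Delta>" for B
  proof (cases B)
    case (Box A)
    then have "m A \<in> reach w" "\<not> sat A (m A)"
      using B m[of A] As by (auto simp: w_def intro: reach_self)
    then show ?thesis by (auto simp: Box)
  next
    case (Atom p)
    then show ?thesis using B disjoint by (auto simp: w_def)
  qed (use B right in auto)
  moreover have "\<forall>A \<in># \<Gamma>. sat A w" using left by (fastforce simp: w_def)
  moreover have "sat (Box A) v" if "v \<in> set (children w)" "A \<in># \<Theta>" for v A
    using that m As by (auto simp: w_def simp del: sat.simps)
  ultimately show False using sound by auto
qed

text \<open>
  Any reducible formula of \<open>\<Gamma>\<close> or \<open>\<Delta>\<close> other than a box on the right may be decomposed at once. A box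
  on the right has to wait: its right premise keeps only boxes from the left side, so it is
  formed when all these boxes have been collected in \<open>\<Theta>\<close>. The left premise of the
  box rule stays sound because \<open>\<box>A\<close> implies \<open>A\<close> at the root.
\<close>

lemma sound_goal_step:
  assumes "sound_goal x"
  shows "\<exists>r xs. grz r (map goal_sequent xs) (goal_sequent x) \<and>
    (\<forall>i < length xs. sound_goal (xs ! i) \<and>
       (r = BoxRule \<and> i = 1 \<or> goal_weight (xs ! i) < goal_weight x))"
proof -
  obtain \<Gamma> \<Theta> \<Delta> where x: "x = (\<Gamma>, \<Theta>, \<Delta>)" by (cases x)
  have stepI: ?thesis if "grz r (map goal_sequent xs) (goal_sequent x)"
    and "\<forall>i < length xs. sound_goal (xs ! i) \<and>
           (r = BoxRule \<and> i = 1 \<or> goal_weight (xs ! i) < goal_weight x)" for r xs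
    using that by blast
  consider (bot) "Bot \<in># \<Gamma>" | (impL) A B where "Imp A B \<in># \<Gamma>" | (boxL) A where "Box A \<in># \<Gamma>"
    | (impR) A B where "Imp A B \<in># \<Delta>" | (ax) p where "Atom p \<in># \<Gamma>" "Atom p \<in># \<Delta>"
    | (irreducible) "\<And>A. A \<in># \<Gamma> \<Longrightarrow> \<exists>p. A = Atom p" "\<And>A B. Imp A B \<notin># \<Delta>"
        "\<And>p. Atom p \<in># \<Gamma> \<Longrightarrow> Atom p \<notin># \<Delta>"
    by (metis fm.exhaust)
  then show ?thesis
  proof cases
    case bot
    then obtain \<Gamma>' where "\<Gamma> = add_mset Bot \<Gamma>'" by (meson mset_add)
    then show ?thesis
      using grz.init_bot[of "\<Gamma>' + image_mset Box \<Theta>" \<Delta>]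
      by (intro exI[of _ Initial] exI[of _ "[]"]) (simp add: x)
  next
    case (ax p)
    then obtain \<Gamma>' \<Delta>' where "\<Gamma> = add_mset (Atom p) \<Gamma>'" "\<Delta> = add_mset (Atom p) \<Delta>'"
      by (meson mset_add)
    then show ?thesis
      using grz.init_atom[of "\<Gamma>' + image_mset Box \<Theta>" p \<Delta>']
      by (intro exI[of _ Initial] exI[of _ "[]"]) (simp add: x)
  next
    case (impL A B)
    then obtain \<Gamma>' where \<Gamma>: "\<Gamma> = add_mset (Imp A B) \<Gamma>'" by (meson mset_add)
    have inf: "grz ImpL (map goal_sequent [(add_mset B \<Gamma>', \<Theta>, \<Delta>), (\<Gamma>', \<Theta>, add_mset A \<Delta>)])
        (goal_sequent x)"
      using grz.impL[of "\<Gamma>' + image_mset Box \<Theta>" B \<Delta> A] by (simp add: x \<Gamma>)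
    moreover have "sound_goal (add_mset B \<Gamma>', \<Theta>, \<Delta>)" "sound_goal (\<Gamma>', \<Theta>, add_mset A \<Delta>)"
      using assms by (auto simp: x \<Gamma>)
    ultimately show ?thesis
      by (intro stepI[OF inf]) (auto simp: x \<Gamma> less_Suc_eq)
  next
    case (boxL A)
    then obtain \<Gamma>' where \<Gamma>: "\<Gamma> = add_mset (Box A) \<Gamma>'" by (meson mset_add)
    have inf: "grz Refl (map goal_sequent [(add_mset A \<Gamma>', add_mset A \<Theta>, \<Delta>)]) (goal_sequent x)"
      using grz.refl[of "\<Gamma>' + image_mset Box \<Theta>" A \<Delta>] by (simp add: x \<Gamma>)
    moreover have "sound_goal (add_mset A \<Gamma>', add_mset A \<Theta>, \<Delta>)"
      unfolding sound_goal.simps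
    proof (intro allI impI)
      fix w assume w: "refutes w (add_mset A \<Gamma>' \<Rightarrow>\<^sub>s \<Delta>)"
      \<comment> \<open>Since \<open>A\<close> holds at the root, \<open>\<box>A\<close> can only fail at a child, where the extended \<open>\<Theta>\<close> records it.\<close>
      show "\<exists>v \<in> set (children w). \<exists>C \<in># add_mset A \<Theta>. \<not> sat (Box C) v"
      proof (cases "sat (Box A) w")
        case True
        with w have "refutes w (\<Gamma> \<Rightarrow>\<^sub>s \<Delta>)" by (simp add: \<Gamma> del: sat.simps)
        then obtain v C where "v \<in> set (children w)" "C \<in># \<Theta>" "\<not> sat (Box C) v"
          using assms unfolding x sound_goal.simps by blast
        then show ?thesis by (intro bexI[of _ v] bexI[of _ C]) (simp_all del: sat.simps)
      next
        case False
        with w show ?thesis using sat_Box_children[of A w] by (auto simp del: sat.simps)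
      qed
    qed
    ultimately show ?thesis
      by (intro stepI[OF inf]) (auto simp: x \<Gamma>)
  next
    case (impR A B)
    then obtain \<Delta>' where \<Delta>: "\<Delta> = add_mset (Imp A B) \<Delta>'" by (meson mset_add)
    have inf: "grz ImpR (map goal_sequent [(add_mset A \<Gamma>, \<Theta>, add_mset B \<Delta>')]) (goal_sequent x)"
      using grz.impR[of "\<Gamma> + image_mset Box \<Theta>" A B \<Delta>'] by (simp add: x \<Delta>)
    moreover have "sound_goal (add_mset A \<Gamma>, \<Theta>, add_mset B \<Delta>')"
      using assms by (auto simp: x \<Delta>)
    ultimately show ?thesis
      by (intro stepI[OF inf]) (auto simp: x \<Delta>)
  next
    case irreducible
    then obtain A where A: "Box A \<in># \<Delta>" "sound_goal (image_mset Box \<Theta>, {#}, {#A#})"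
      using sound_goal_irreducible assms[unfolded x] by metis
    then obtain \<Delta>' where \<Delta>: "\<Delta> = add_mset (Box A) \<Delta>'" by (meson mset_add)
    have inf: "grz BoxRule
        (map goal_sequent [(\<Gamma>, \<Theta>, add_mset A \<Delta>'), (image_mset Box \<Theta>, {#}, {#A#})])
        (goal_sequent x)"
      using grz.box[of \<Gamma> \<Theta> A \<Delta>'] by (simp add: x \<Delta>)
    moreover have "sound_goal (\<Gamma>, \<Theta>, add_mset A \<Delta>')"
      using assms by (auto simp: x \<Delta> simp del: sat.simps dest: sat_Box_refl)
    ultimately show ?thesis using A(2)
      by (intro stepI[OF inf]) (auto simp: x \<Delta> less_Suc_eq simp del: sound_goal.simps)
  qed
qed

section \<open>Cut elimination\<close>

lemma grz_complete:
  assumes "\<And>w. \<not> refutes w (\<Gamma> \<Rightarrow>\<^sub>s \<Delta>)"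
  shows "provable grz (\<Gamma> \<Rightarrow>\<^sub>s \<Delta>)"
proof -
  have "provable grz (goal_sequent (\<Gamma>, {#}, \<Delta>))"
    using assms by (intro provable_if_steps[of sound_goal, OF sound_goal_step]) auto
  then show ?thesis by simp
qed

theorem theorem4p9:
  fixes \<Gamma> \<Delta> :: "'a fm multiset"
  assumes "provable grz_cut (\<Gamma> \<Rightarrow>\<^sub>s \<Delta>)"
  shows "provable grz (\<Gamma> \<Rightarrow>\<^sub>s \<Delta>)"
proof (rule grz_complete)
  fix w
  obtain t where "infinity_proof grz_cut t" "concl t = (\<Gamma> \<Rightarrow>\<^sub>s \<Delta>)"
    using assms by (auto simp: provable_def)
  then show "\<not> refutes w (\<Gamma> \<Rightarrow>\<^sub>s \<Delta>)" using refutes_concl_contradiction by metis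
qed

end
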